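(* Assume that $A \in M_{n\times n}(\mathbb{R})$ is an irreducible matrix with sign-constant elements off the diagonal. Then $\lambda_{S_+}(A)$ is a simple eigenvalue of $A$, and the right and left quasi-eigenvectors $u_{S_+}, v_{S_+}$ of $A$ in $S_+$ are the corresponding positive right and left eigenvectors. Moreover, $(u_{S_+}, v_{S_+})$ is a saddle point of $\lambda(u,v)$ in $S_+\times S_+$, which is unique up to multipliers of $u_{S_+}$ and $v_{S_+}$. Furthermore, the function $\lambda_{S_+}(\cdot)$ is continuous on $(M_{n\times n}(\mathbb{R}),\|\cdot\|_M)$ at any such $A$ in the following sense: $$\max\{|\underline{\lambda}_{S_+}(A+D)-\lambda_{S_+}(A)|,\ |\overline{\lambda}_{S_+}(A+D)-\lambda_{S_+}(A)|\}\leq c_0(A,S_+)\, \|D\|_M\quad \forall D\in M_{n\times n}(\mathbb{R}),$$ where $c_0(A,S_+)$ does not depend on $D$. Moreover, $\underline{\lambda}_{S_+}(A+D)\geq \lambda_{S_+}(A)$ if $D\geq 0$, and $\overline{\lambda}_{S_+}(A+D)\leq \lambda_{S_+}(A)$ if $D\leq 0$.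
   Context: $M_{n\times n}(\mathbb{R})$ is the space of real $n\times n$ matrices with the standard operator norm $\|\cdot\|_M$; $\langle\cdot,\cdot\rangle$ is the inner product on $\mathbb{R}^n$ and $\|\cdot\|$ the corresponding norm. $S_+^o=\{u\in\mathbb{R}^n\mid u_i>0,\ i=1,\dots,n\}$ and $S_+=\overline{S_+^o}\setminus\{0\}$. A matrix is irreducible if it cannot be conjugated into block upper triangular form by a permutation matrix. A matrix $A=(a_{i,j})$ has sign-constant elements off the diagonal if either $a_{i,j}\ge 0$ for all $i\ne j$, or $a_{i,j}\le 0$ for all $i\neq j$. The inequalities $D\ge0$, $D\le 0$ are entrywise. For a matrix $B$, write $\lambda_B(u,v):=\frac{\langle Bu,v\rangle}{\langle u,v\rangle}$ when $\langle u,v\rangle\ne0$; $\lambda(u,v)$ without subscript refers to $B=A$. The upper and lower quasi-eigenvalues of $B$ in $S_+$ are $\overline{\lambda}_{S_+}(B):=\sup_{u\in S_+}\inf_{v\in S_+^o}\lambda_B(u,v)$ and $\underline{\lambda}_{S_+}(B):=\inf_{v\in S_+}\sup_{u\in S_+^o}\lambda_B(u,v)$; when they coincide, $\lambda_{S_+}(B)$ denotes their common value (part of the theorem is that they coincide for $B=A$). A right quasi-eigenvector of $A$ in $S_+$ is a vector $u_{S_+}\in S_+$ with $\overline{\lambda}_{S_+}(A)=\inf_{v\in S_+^o}\lambda(u_{S_+},v)$; a left quasi-eigenvector is a vector $v_{S_+}\in S_+$ with $\underline{\lambda}_{S_+}(A)=\sup_{u\in S_+^o}\lambda(u,v_{S_+})$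 (such vectors always exist). The pair $(u_{S_+},v_{S_+})$ is a saddle point of $\lambda(u,v)$ in $S_+\times S_+$ if $\partial_u\lambda(u_{S_+},v_{S_+})=0$, $\partial_v\lambda(u_{S_+},v_{S_+})=0$ and $\overline{\lambda}_{S_+}(A)=\underline{\lambda}_{S_+}(A)=\lambda(u_{S_+},v_{S_+})$. A left eigenvector of $A$ with eigenvalue $\mu$ is a nonzero $v$ with $A^Tv=\mu v$. The constant is $c_0(A,S_+):=\max\Big\{\sup_{u\in S_+}\frac{\|u\|}{\langle u,v_{S_+}\rangle},\ \sup_{v\in S_+}\frac{\|v\|}{\langle u_{S_+},v\rangle}\Big\}$.
   Formalization: The perturbation bound with c_0(A,S_+) is stated for quasi-eigenvectors u_{S_+}, v_{S_+} of norm one, since c_0 depends on their scaling and the bound fails otherwise (n=1, u=v=2 gives c_0=1/2 but the left side is |D|). *)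

theory Defs
  imports "HOL-Analysis.Analysis" "HOL-Computational_Algebra.Polynomial"
begin

definition S_pos :: "(real ^ 'n) set"
  where "S_pos = {u. \<forall>i. 0 < u $ i}"

definition S_plus :: "(real ^ 'n) set"
  where "S_plus = closure S_pos - {0}"

definition sign_constant_off_diag :: "real ^ 'n ^ 'n \<Rightarrow> bool"
  where "sign_constant_off_diag A \<longleftrightarrow>
    (\<forall>i j. i \<noteq> j \<longrightarrow> 0 \<le> A $ i $ j) \<or> (\<forall>i j. i \<noteq> j \<longrightarrow> A $ i $ j \<le> 0)"

definition permutation_matrix :: "('n \<Rightarrow> 'n) \<Rightarrow> real ^ 'n ^ 'n"
  where "permutation_matrix p = (\<chi> i j. if j = p i then 1 else 0)"

text \<open>
  The index type carries a linear order, so that block triangularity makes sense. The index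
  \<open>k\<close> is the first one of the second diagonal block; the existence of some \<open>i < k\<close> makes
  both diagonal blocks nonempty. In particular every 1 by 1 matrix is irreducible.
\<close>

definition block_upper_triangular :: "real ^ 'n::{finite,linorder} ^ 'n::{finite,linorder} \<Rightarrow> bool"
  where "block_upper_triangular B \<longleftrightarrow>
    (\<exists>k. (\<exists>i. i < k) \<and> (\<forall>i j. k \<le> i \<and> j < k \<longrightarrow> B $ i $ j = 0))"

text \<open>The transpose of a permutation matrix is its inverse.\<close>

definition irreducible_matrix :: "real ^ 'n::{finite,linorder} ^ 'n::{finite,linorder} \<Rightarrow> bool"
  where "irreducible_matrix A \<longleftrightarrow>
    \<not> (\<exists>p. p permutes UNIV \<and>
      block_upper_triangular
        (permutation_matrix p ** A ** transpose (permutation_matrix p)))"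

definition charpoly :: "real ^ 'n ^ 'n \<Rightarrow> real poly"
  where "charpoly A = det (\<chi> i j. (if i = j then [:0, 1:] else 0) - [:A $ i $ j:])"

text \<open>Simplicity is algebraic: the eigenvalue is a simple root of the characteristic polynomial.\<close>

definition simple_eigenvalue :: "real ^ 'n ^ 'n \<Rightarrow> real \<Rightarrow> bool"
  where "simple_eigenvalue A \<mu> \<longleftrightarrow>
    (\<exists>x. x \<noteq> 0 \<and> A *v x = \<mu> *\<^sub>R x) \<and> order \<mu> (charpoly A) = 1"

definition lam :: "real ^ 'n ^ 'n \<Rightarrow> real ^ 'n \<Rightarrow> real ^ 'n \<Rightarrow> real"
  where "lam B u v = ((B *v u) \<bullet> v) / (u \<bullet> v)"

text \<open>
  The inner infimum (supremum) is \<open>-\<infinity>\<close> (\<open>\<infinity>\<close>) for some boundary vectors, hence the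
  extended reals. The denominators occurring here are positive.
\<close>

definition upper_qev :: "real ^ 'n ^ 'n \<Rightarrow> ereal"
  where "upper_qev B = (SUP u\<in>S_plus. INF v\<in>S_pos. ereal (lam B u v))"

definition lower_qev :: "real ^ 'n ^ 'n \<Rightarrow> ereal"
  where "lower_qev B = (INF v\<in>S_plus. SUP u\<in>S_pos. ereal (lam B u v))"

definition right_quasi_eigenvector :: "real ^ 'n ^ 'n \<Rightarrow> real ^ 'n \<Rightarrow> bool"
  where "right_quasi_eigenvector A u \<longleftrightarrow>
    u \<in> S_plus \<and> upper_qev A = (INF v\<in>S_pos. ereal (lam A u v))"

definition left_quasi_eigenvector :: "real ^ 'n ^ 'n \<Rightarrow> real ^ 'n \<Rightarrow> bool"
  where "left_quasi_eigenvector A v \<longleftrightarrow>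
    v \<in> S_plus \<and> lower_qev A = (SUP u\<in>S_pos. ereal (lam A u v))"

text \<open>
  The condition \<open>u \<bullet> v \<noteq> 0\<close> says that \<open>lam A u v\<close> is defined, which is not automatic for
  boundary vectors.
\<close>

definition saddle_point :: "real ^ 'n ^ 'n \<Rightarrow> real ^ 'n \<Rightarrow> real ^ 'n \<Rightarrow> bool"
  where "saddle_point A u v \<longleftrightarrow>
    u \<in> S_plus \<and> v \<in> S_plus \<and> u \<bullet> v \<noteq> 0 \<and>
    GDERIV (\<lambda>x. lam A x v) u :> 0 \<and>
    GDERIV (\<lambda>y. lam A u y) v :> 0 \<and>
    upper_qev A = ereal (lam A u v) \<and> lower_qev A = ereal (lam A u v)"

text \<open>
  The constant \<open>c0\<close> is not invariant under scaling of \<open>u0\<close> and \<open>v0\<close>; it is meant for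
  entrywise positive vectors of norm one.
\<close>

definition c0 :: "real ^ 'n \<Rightarrow> real ^ 'n \<Rightarrow> ereal"
  where "c0 u0 v0 =
    max (SUP u\<in>S_plus. ereal (norm u / (u \<bullet> v0)))
        (SUP v\<in>S_plus. ereal (norm v / (u0 \<bullet> v)))"

end

theory Submission
  imports Defs
begin

text \<open>
  Brouwer's fixed point theorem gives nonnegative right and left eigenvectors, irreducibility makes
  them positive, and pairing them with each other shows that their eigenvalues agree. Evaluating
  \<open>lam\<close> at the positive right eigenvector \<open>u\<close> bounds the quasi-eigenvalues from below, and at the
  positive left eigenvector \<open>v\<close> from above. For \<open>A\<close> itself both bounds are the eigenvalue \<open>l\<close>; for
  \<open>A + D\<close> they differ from \<open>l\<close> by values of \<open>lam D\<close>, which gives the continuity estimate and the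
  monotonicity. A right quasi-eigenvector satisfies \<open>A x \<ge> l x\<close> entrywise, and pairing with \<open>v\<close>
  forces equality; dually for left quasi-eigenvectors.
\<close>

section \<open>The open orthant, its closure and the inner product\<close>

text \<open>A nonnegative vector is approximated from inside by adding multiples of the all-ones
  vector \<open>1\<close> that tend to 0, so taking the closure of \<open>S_pos\<close> only relaxes
  the strict inequalities.\<close>

lemma S_plus_iff:
  fixes u :: "real ^ 'n"
  shows "u \<in> S_plus \<longleftrightarrow> (\<forall>i. 0 \<le> u $ i) \<and> u \<noteq> 0"
proof -
  have "closure (S_pos :: (real ^ 'n) set) = {u. \<forall>i. 0 \<le> u $ i}"
  proof
    have "closed {u :: real ^ 'n. \<forall>i. 0 \<le> u $ i}"
      by (intro closed_Collect_all closed_Collect_le continuous_intros)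
    then show "closure (S_pos :: (real ^ 'n) set) \<subseteq> {u. \<forall>i. 0 \<le> u $ i}"
      by (intro closure_minimal) (auto simp: S_pos_def less_imp_le)
  next
    show "{u. \<forall>i. 0 \<le> u $ i} \<subseteq> closure (S_pos :: (real ^ 'n) set)"
    proof
      fix u :: "real ^ 'n"
      assume u: "u \<in> {u. \<forall>i. 0 \<le> u $ i}"
      let ?f = "\<lambda>n. u + inverse (real (Suc n)) *\<^sub>R 1"
      have "?f \<longlonglongrightarrow> u + 0 *\<^sub>R 1"
        by (intro tendsto_intros LIMSEQ_inverse_real_of_nat)
      moreover have "?f n \<in> S_pos" for n
        using u by (auto simp: S_pos_def intro!: add_nonneg_pos)
      ultimately show "u \<in> closure S_pos"
        unfolding closure_sequential by (intro exI[of _ ?f]) auto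
    qed
  qed
  then show ?thesis
    by (auto simp: S_plus_def)
qed

lemma S_pos_subset_S_plus: "S_pos \<subseteq> S_plus"
  unfolding S_plus_iff subset_iff by (auto simp: S_pos_def less_imp_le)

text \<open>No summand of the inner product is negative and at least one is positive. This keeps the
  denominators of \<open>lam\<close> positive.\<close>

lemma inner_S_plus_S_pos:
  assumes "u \<in> S_plus" "v \<in> S_pos"
  shows "0 < u \<bullet> v"
proof -
  obtain i where "u $ i \<noteq> 0"
    using assms(1) by (auto simp: S_plus_iff vec_eq_iff)
  then have "0 < u $ i * v $ i"
    using assms by (auto simp: S_plus_iff S_pos_def less_le)
  then show ?thesis
    using assms unfolding inner_vec_def
    by (intro sum_pos2[of _ i]) (auto simp: S_plus_iff S_pos_def less_imp_le)
qed

lemma inner_S_pos_S_plus: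
  assumes "u \<in> S_pos" "v \<in> S_plus"
  shows "0 < u \<bullet> v"
  using inner_S_plus_S_pos[OF assms(2,1)] by (simp add: inner_commute)

lemma open_S_pos: "open (S_pos :: (real ^ 'n) set)"
proof -
  have "open (\<Inter>i. {u :: real ^ 'n. 0 < u $ i})"
    by (intro open_INT ballI finite open_Collect_less continuous_intros)
  also have "(\<Inter>i. {u :: real ^ 'n. 0 < u $ i}) = S_pos"
    by (auto simp: S_pos_def)
  finally show ?thesis .
qed

lemma scaleR_S_pos: "c > 0 \<Longrightarrow> u \<in> S_pos \<Longrightarrow> c *\<^sub>R u \<in> S_pos"
  by (simp add: S_pos_def)

text \<open>Since \<open>S_pos\<close> is open, a short step from \<open>v0\<close> against the
  direction \<open>w\<close> stays inside and would make the functional negative if \<open>w\<close>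
  were nonzero.\<close>

lemma inner_nonneg_on_S_pos_eq_0:
  fixes w :: "real ^ 'n"
  assumes nonneg: "\<And>v. v \<in> S_pos \<Longrightarrow> 0 \<le> w \<bullet> v"
    and "v0 \<in> S_pos" "w \<bullet> v0 = 0"
  shows "w = 0"
proof (rule ccontr)
  assume "w \<noteq> 0"
  obtain e where e: "e > 0" "ball v0 e \<subseteq> S_pos"
    using open_S_pos assms(2) open_contains_ball by blast
  define r where "r = e / (2 * norm w)"
  have "r > 0" "r * norm w < e"
    using e \<open>w \<noteq> 0\<close> by (auto simp: r_def)
  then have "v0 - r *\<^sub>R w \<in> S_pos"
    using e by (auto simp: dist_norm subset_iff)
  from nonneg[OF this] have "r * (w \<bullet> w) \<le> 0"
    using assms(3) by (simp add: inner_diff_right)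
  then show False
    using \<open>r > 0\<close> \<open>w \<noteq> 0\<close> mult_pos_pos[of r "w \<bullet> w"] inner_gt_zero_iff[of w] by linarith
qed

lemma uminus_matrix_vector_mult:
  fixes A :: "'a::ring_1 ^ 'n ^ 'm"
  shows "(- A) *v x = - (A *v x)"
  by (simp add: matrix_vector_mult_def vec_eq_iff sum_negf)

lemma transpose_uminus: "transpose (- A) = - transpose A"
  by (simp add: transpose_def vec_eq_iff)

lemma inner_matrix_transpose:
  fixes A :: "real ^ 'n ^ 'm"
  shows "(A *v u) \<bullet> v = u \<bullet> (transpose A *v v)"
  by (metis dot_lmul_matrix inner_commute transpose_matrix_vector)

section \<open>Positive eigenvectors\<close>

lemma permutation_matrix_conj:
  fixes A :: "real ^ 'n ^ 'n"
  shows "(permutation_matrix p ** A ** transpose (permutation_matrix p)) $ i $ j = A $ p i $ p j"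
proof -
  have "(permutation_matrix p ** A) $ i $ k = A $ p i $ k" for k
    by (simp add: matrix_matrix_mult_def permutation_matrix_def if_distrib[of "\<lambda>x. x * _"] cong: if_cong)
  then show ?thesis
    by (subst matrix_matrix_mult_def)
      (simp add: transpose_def permutation_matrix_def if_distrib[of "\<lambda>x. _ * x"] cong: if_cong)
qed

text \<open>Block triangularity is cut at an index, not at a size; this supplies the cut for a block
  of prescribed size. The map \<open>k \<mapsto> card {..<k}\<close> is strictly increasing, hence
  injective, and counting shows that it takes every value below \<open>CARD('n)\<close>.\<close>

lemma ex_card_lessThan:
  assumes "m < CARD('n::{finite,linorder})"
  shows "\<exists>k::'n. card {..<k} = m"
proof -
  let ?f = "\<lambda>k::'n. card {..<k}"
  have "?f a < ?f b" if "a < b" for a b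
    using that by (intro psubset_card_mono) auto
  then have inj: "inj ?f"
    by (intro linorder_injI) (metis less_irrefl)
  have sub: "?f ` UNIV \<subseteq> {..<CARD('n)}"
    by (auto intro!: psubset_card_mono)
  have "?f ` UNIV = {..<CARD('n)}"
    by (rule card_subset_eq[OF _ sub]) (auto simp: card_image[OF inj])
  then have "m \<in> ?f ` UNIV"
    using assms by simp
  then show ?thesis
    by auto
qed

text \<open>In the digraph with an edge from \<open>i\<close> to \<open>j\<close> whenever
  \<open>A $ i $ j \<noteq> 0\<close>, every nonempty proper set of indices has an outgoing edge.
  This form avoids permutations and the order on the indices.\<close>

definition strongly_connected :: "real ^ 'n ^ 'n \<Rightarrow> bool"
  where "strongly_connected A \<longleftrightarrow>
    (\<forall>Z. Z \<noteq> {} \<and> Z \<noteq> UNIV \<longrightarrow> (\<exists>i\<in>Z. \<exists>j\<in>-Z. A $ i $ j \<noteq> 0))"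

text \<open>If no edge leaves \<open>Z\<close>, a permutation that lists the complement of
  \<open>Z\<close> first and \<open>Z\<close> afterwards makes the lower left block zero.\<close>

lemma irreducible_imp_strongly_connected:
  fixes A :: "real ^ 'n::{finite,linorder} ^ 'n::{finite,linorder}"
  assumes "irreducible_matrix A"
  shows "strongly_connected A"
  unfolding strongly_connected_def
proof (intro allI impI, rule ccontr)
  fix Z :: "'n set"
  assume Z: "Z \<noteq> {} \<and> Z \<noteq> UNIV" and "\<not> (\<exists>i\<in>Z. \<exists>j\<in>-Z. A $ i $ j \<noteq> 0)"
  then have zero: "A $ i $ j = 0" if "i \<in> Z" "j \<notin> Z" for i j
    using that by auto
  have "card (-Z) < CARD('n)"
    using Z by (intro psubset_card_mono) auto
  then obtain k :: 'n where k: "card {..<k} = card (-Z)"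
    using ex_card_lessThan by blast
  have "card {k..} = card Z"
  proof -
    have "card {..<k} + card {k..} = CARD('n)"
      by (subst card_Un_disjoint[symmetric]) (auto intro: arg_cong[where f = card])
    moreover have "card (-Z) + card Z = CARD('n)"
      by (subst card_Un_disjoint[symmetric]) (auto intro: arg_cong[where f = card])
    ultimately show ?thesis
      using k by simp
  qed
  then obtain g where g: "bij_betw g {k..} Z"
    using finite_same_card_bij by (metis finite)
  obtain f where f: "bij_betw f {..<k} (-Z)"
    using finite_same_card_bij k by (metis finite)
  define p where "p i = (if i \<in> {..<k} then f i else g i)" for i
  have "bij_betw p ({..<k} \<union> {k..}) (-Z \<union> Z)"
    unfolding p_def
    by (rule bij_betw_disjoint_Un[OF f g]) auto
  moreover have "{..<k} \<union> {k..} = UNIV"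
    by auto
  ultimately have "bij p"
    by simp
  then have "p permutes UNIV"
    by (intro bij_imp_permutes) auto
  have "-Z \<noteq> {}"
    using Z by auto
  then have "{..<k} \<noteq> {}"
    using k by (metis card_eq_0_iff finite)
  moreover have "A $ p i $ p j = 0" if "k \<le> i" "j < k" for i j
  proof -
    have "p i \<in> Z" "p j \<in> -Z"
      using that f g by (auto simp: p_def bij_betw_def)
    then show ?thesis
      using zero by auto
  qed
  ultimately have "block_upper_triangular
      (permutation_matrix p ** A ** transpose (permutation_matrix p))"
    unfolding block_upper_triangular_def permutation_matrix_conj by blast
  then show False
    using assms \<open>p permutes UNIV\<close> unfolding irreducible_matrix_def by blast
qed

text \<open>Reversing the edges turns an edge that leaves the complement of \<open>Z\<close> into
  one that leaves \<open>Z\<close>.\<close>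

lemma strongly_connected_transpose:
  assumes "strongly_connected A"
  shows "strongly_connected (transpose A)"
  unfolding strongly_connected_def
proof (intro allI impI)
  fix Z :: "'a set"
  assume "Z \<noteq> {} \<and> Z \<noteq> UNIV"
  then have "-Z \<noteq> {} \<and> -Z \<noteq> UNIV"
    by auto
  then have "\<exists>i\<in>-Z. \<exists>j\<in>- (- Z). A $ i $ j \<noteq> 0"
    using assms[unfolded strongly_connected_def, rule_format, of "-Z"] by fast
  then show "\<exists>i\<in>Z. \<exists>j\<in>-Z. transpose A $ i $ j \<noteq> 0"
    by (auto simp: transpose_def)
qed

lemma sign_constant_off_diag_transpose:
  "sign_constant_off_diag A \<Longrightarrow> sign_constant_off_diag (transpose A)"
  unfolding sign_constant_off_diag_def transpose_def by auto

section \<open>Positivity, existence and uniqueness of nonnegative eigenvectors\<close>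

text \<open>In a row \<open>i\<close> with \<open>x $ i = 0\<close> the eigenvalue equation says
  that a sum vanishes. Its diagonal term is 0 and the other terms share one sign, so each of them is
  0. An edge leaving the zero set of \<open>x\<close> contradicts this.\<close>

lemma nonneg_eigenvector_pos:
  fixes A :: "real ^ 'n ^ 'n"
  assumes conn: "strongly_connected A" and sign: "sign_constant_off_diag A"
    and x: "x \<in> S_plus" and eig: "A *v x = l *\<^sub>R x"
  shows "x \<in> S_pos"
proof (rule ccontr)
  assume "x \<notin> S_pos"
  have nonneg: "0 \<le> x $ i" for i
    using x by (simp add: S_plus_iff)
  define Z where "Z = {i. x $ i = 0}"
  have "Z \<noteq> {}"
    using \<open>x \<notin> S_pos\<close> nonneg by (force simp: Z_def S_pos_def less_le)
  moreover have "Z \<noteq> UNIV"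
    using x by (auto simp: Z_def S_plus_iff vec_eq_iff)
  ultimately obtain i j where ij: "i \<in> Z" "j \<notin> Z" "A $ i $ j \<noteq> 0"
    using conn[unfolded strongly_connected_def, rule_format, of Z] by blast
  have sum0: "(\<Sum>k\<in>UNIV. A $ i $ k * x $ k) = 0"
    using arg_cong[OF eig, of "\<lambda>y. y $ i"] ij(1) by (simp add: matrix_vector_mult_def Z_def)
  from sign have "A $ i $ j * x $ j = 0"
    unfolding sign_constant_off_diag_def
  proof
    assume "\<forall>i j. i \<noteq> j \<longrightarrow> 0 \<le> A $ i $ j"
    then have "0 \<le> A $ i $ k * x $ k" for k
      using nonneg ij(1) by (cases "k = i") (auto simp: Z_def)
    then show ?thesis
      using sum0 by (simp add: sum_nonneg_eq_0_iff)
  next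
    assume "\<forall>i j. i \<noteq> j \<longrightarrow> A $ i $ j \<le> 0"
    then have "A $ i $ k * x $ k \<le> 0" for k
      using nonneg ij(1) by (cases "k = i") (auto simp: Z_def mult_nonpos_nonneg)
    then show ?thesis
      using sum0 sum_nonneg_eq_0_iff[of UNIV "\<lambda>k. - (A $ i $ k * x $ k)"]
      by (simp add: sum_negf)
  qed
  then show False
    using ij by (simp add: Z_def)
qed

text \<open>Brouwer's theorem applied to the normalised map \<open>A + s I\<close> on the standard simplex.\<close>

lemma ex_nonneg_eigenvector_of_nonneg_off_diag:
  fixes A :: "real ^ 'n ^ 'n"
  assumes off: "\<And>i j. i \<noteq> j \<Longrightarrow> 0 \<le> A $ i $ j"
  shows "\<exists>l x. x \<in> S_plus \<and> A *v x = l *\<^sub>R x"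
proof -
  \<comment> \<open>The shift raises every diagonal entry to at least 1, so \<open>T\<close> keeps
    positive coordinates positive and the normalisation never divides by 0.\<close>
  define s where "s = 1 + (\<Sum>i\<in>UNIV. \<bar>A $ i $ i\<bar>)"
  have s: "0 < A $ i $ i + s" for i
    using member_le_sum[of i UNIV "\<lambda>i. \<bar>A $ i $ i\<bar>"] by (simp add: s_def)
  define T where "T x = A *v x + s *\<^sub>R x" for x
  define \<sigma> :: "real ^ 'n \<Rightarrow> real" where "\<sigma> x = (\<Sum>i\<in>UNIV. x $ i)" for x
  define S :: "(real ^ 'n) set" where "S = {x. (\<forall>i. 0 \<le> x $ i) \<and> \<sigma> x = 1}"
  have T_ge: "0 \<le> T x $ i" "(A $ i $ i + s) * x $ i \<le> T x $ i" if "\<And>i. 0 \<le> x $ i" for x i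
  proof -
    have "T x $ i = (A $ i $ i + s) * x $ i + (\<Sum>j\<in>UNIV - {i}. A $ i $ j * x $ j)"
      by (simp add: T_def matrix_vector_mult_def sum.remove[of UNIV i] algebra_simps)
    moreover have "0 \<le> (\<Sum>j\<in>UNIV - {i}. A $ i $ j * x $ j)"
      using off that by (intro sum_nonneg) auto
    moreover have "0 \<le> (A $ i $ i + s) * x $ i"
      using s[of i] that by simp
    ultimately show "0 \<le> T x $ i" "(A $ i $ i + s) * x $ i \<le> T x $ i"
      by auto
  qed
  have \<sigma>_pos: "0 < \<sigma> (T x)" if "x \<in> S" for x
  proof -
    have nonneg: "0 \<le> x $ i" for i
      using that by (simp add: S_def)
    have "\<exists>i. x $ i \<noteq> 0"
    proof (rule ccontr)
      assume "\<nexists>i. x $ i \<noteq> 0"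
      then show False
        using that by (simp add: S_def \<sigma>_def)
    qed
    then obtain i where "0 < x $ i"
      using nonneg by (auto simp: less_le)
    then have "0 < T x $ i"
      using T_ge(2)[of x i, OF nonneg] s[of i] by (meson less_le_trans mult_pos_pos)
    then show ?thesis
      unfolding \<sigma>_def using T_ge(1)[of x, OF nonneg] by (intro sum_pos2[of _ i]) auto
  qed
  have "compact S"
  proof -
    have "closed S"
      unfolding S_def \<sigma>_def
      by (intro closed_Collect_conj closed_Collect_all closed_Collect_le closed_Collect_eq continuous_intros)
    moreover have "norm x \<le> 1" if "x \<in> S" for x
      using norm_le_l1_cart[of x] that by (simp add: S_def \<sigma>_def)
    ultimately show ?thesis
      by (auto simp: compact_eq_bounded_closed bounded_iff)
  qed
  moreover have "convex S"
    by (auto simp: convex_def S_def \<sigma>_def sum.distrib simp flip: sum_distrib_left)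
  moreover have "S \<noteq> {}"
  proof -
    have "(\<chi> i. 1 / real CARD('n)) \<in> S"
      by (simp add: S_def \<sigma>_def)
    then show ?thesis
      by blast
  qed
  moreover have "continuous_on S (\<lambda>x. inverse (\<sigma> (T x)) *\<^sub>R T x)"
    using \<sigma>_pos unfolding \<sigma>_def T_def
    by (intro continuous_intros matrix_vector_mult_linear_continuous_on) force
  moreover have "inverse (\<sigma> (T x)) *\<^sub>R T x \<in> S" if "x \<in> S" for x
    using \<sigma>_pos[OF that] T_ge(1)[of x] that
    by (auto simp: S_def \<sigma>_def simp flip: sum_distrib_left)
  ultimately obtain x where x: "x \<in> S" "inverse (\<sigma> (T x)) *\<^sub>R T x = x"
    using brouwer[of S "\<lambda>x. inverse (\<sigma> (T x)) *\<^sub>R T x"] by blast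
  \<comment> \<open>A fixed point of the normalised map is an eigenvector of \<open>T\<close>;
    undoing the shift gives the eigenvalue \<open>\<sigma> (T x) - s\<close> of
    \<open>A\<close>.\<close>
  have "T x = \<sigma> (T x) *\<^sub>R (inverse (\<sigma> (T x)) *\<^sub>R T x)"
    using \<sigma>_pos[OF x(1)] by simp
  then have "T x = \<sigma> (T x) *\<^sub>R x"
    using x(2) by simp
  then have "A *v x = (\<sigma> (T x) - s) *\<^sub>R x"
    by (simp add: T_def algebra_simps)
  moreover have "x \<in> S_plus"
    using x(1) by (auto simp: S_plus_iff S_def \<sigma>_def)
  ultimately show ?thesis
    by blast
qed

text \<open>When the off-diagonal entries are nonpositive, pass to \<open>- A\<close>, which has the
  same eigenvectors with negated eigenvalues.\<close>

lemma ex_nonneg_eigenvector: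
  fixes A :: "real ^ 'n ^ 'n"
  assumes "sign_constant_off_diag A"
  shows "\<exists>l x. x \<in> S_plus \<and> A *v x = l *\<^sub>R x"
  using assms unfolding sign_constant_off_diag_def
proof
  assume "\<forall>i j. i \<noteq> j \<longrightarrow> 0 \<le> A $ i $ j"
  then show ?thesis
    using ex_nonneg_eigenvector_of_nonneg_off_diag[of A] by blast
next
  assume "\<forall>i j. i \<noteq> j \<longrightarrow> A $ i $ j \<le> 0"
  then have "\<And>i j. i \<noteq> j \<Longrightarrow> 0 \<le> (- A) $ i $ j"
    by simp
  then obtain l x where "x \<in> S_plus" and "(- A) *v x = l *\<^sub>R x"
    using ex_nonneg_eigenvector_of_nonneg_off_diag[of "- A"] by blast
  then have "x \<in> S_plus \<and> A *v x = (- l) *\<^sub>R x"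
    by (simp add: uminus_matrix_vector_mult minus_equation_iff[of "A *v x"])
  then show ?thesis
    by blast
qed

text \<open>Subtract from \<open>w\<close> the largest multiple of \<open>u\<close> that leaves a
  nonnegative vector. The difference has a zero coordinate and satisfies the same eigenvalue
  equation, so if it were nonzero it would have to be entrywise positive.\<close>

lemma eigenvector_multiple:
  fixes A :: "real ^ 'n ^ 'n"
  assumes conn: "strongly_connected A" and sign: "sign_constant_off_diag A"
    and u: "u \<in> S_pos" "A *v u = l *\<^sub>R u" and w: "A *v w = l *\<^sub>R w"
  shows "\<exists>c. w = c *\<^sub>R u"
proof (rule ccontr)
  assume no: "\<nexists>c. w = c *\<^sub>R u"
  define t where "t = Min (range (\<lambda>i. w $ i / u $ i))"
  have u_pos: "0 < u $ i" for i
    using u(1) by (simp add: S_pos_def)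
  have t_le: "t \<le> w $ i / u $ i" for i
    unfolding t_def by (rule Min_le) auto
  have "0 \<le> (w - t *\<^sub>R u) $ i" for i
    using u_pos[of i] t_le[of i] by (simp add: pos_le_divide_eq)
  then have "w - t *\<^sub>R u \<in> S_plus"
    using no by (auto simp: S_plus_iff)
  moreover have "A *v (w - t *\<^sub>R u) = l *\<^sub>R (w - t *\<^sub>R u)"
    using u(2) w by (simp add: matrix_vector_mult_diff_distrib matrix_vector_mult_scaleR algebra_simps)
  ultimately have pos: "w - t *\<^sub>R u \<in> S_pos"
    using nonneg_eigenvector_pos[OF conn sign] by blast
  have "t \<in> range (\<lambda>i. w $ i / u $ i)"
    unfolding t_def by (rule Min_in) auto
  then obtain i where "t = w $ i / u $ i"
    by blast
  then have "(w - t *\<^sub>R u) $ i = 0"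
    using u_pos[of i] by simp
  then show False
    using pos unfolding S_pos_def by (metis less_irrefl mem_Collect_eq)
qed

text \<open>The facts below on quasi-eigenvalues, saddle points and perturbations use
  \<open>A\<close> only through this data.\<close>

definition positive_eigenpair :: "real ^ 'n ^ 'n \<Rightarrow> real \<Rightarrow> real ^ 'n \<Rightarrow> real ^ 'n \<Rightarrow> bool"
  where "positive_eigenpair A l u v \<longleftrightarrow>
    u \<in> S_pos \<and> v \<in> S_pos \<and> A *v u = l *\<^sub>R u \<and> transpose A *v v = l *\<^sub>R v"

text \<open>The two eigenvectors are found separately, with eigenvalues \<open>l\<close> and
  \<open>m\<close>. Computing \<open>(A *v u) \<bullet> v\<close> in two ways gives
  \<open>l * (u \<bullet> v) = m * (u \<bullet> v)\<close>, and \<open>u \<bullet> v\<close> is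
  positive.\<close>

lemma ex_positive_eigenpair:
  fixes A :: "real ^ 'n ^ 'n"
  assumes "strongly_connected A" and "sign_constant_off_diag A"
  shows "\<exists>l u v. positive_eigenpair A l u v"
proof -
  obtain l u where "u \<in> S_plus" and eu: "A *v u = l *\<^sub>R u"
    using ex_nonneg_eigenvector[OF assms(2)] by blast
  then have u: "u \<in> S_pos"
    using nonneg_eigenvector_pos[OF assms] by blast
  obtain m v where "v \<in> S_plus" and ev: "transpose A *v v = m *\<^sub>R v"
    using ex_nonneg_eigenvector[OF sign_constant_off_diag_transpose[OF assms(2)]] by blast
  then have v: "v \<in> S_pos"
    using nonneg_eigenvector_pos[OF strongly_connected_transpose[OF assms(1)]
        sign_constant_off_diag_transpose[OF assms(2)]] by blast
  have "l * (u \<bullet> v) = m * (u \<bullet> v)"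
    using inner_matrix_transpose[of A u v] unfolding eu ev by simp
  moreover have "0 < u \<bullet> v"
    using inner_S_plus_S_pos[of u v] u v S_pos_subset_S_plus by blast
  ultimately have "m = l"
    by simp
  then show ?thesis
    using u v eu ev unfolding positive_eigenpair_def by blast
qed

section \<open>Simplicity\<close>

text \<open>Evaluation at \<open>x\<close> is a ring homomorphism and the determinant is a
  polynomial in the entries.\<close>

lemma poly_det: "poly (det M) x = det (\<chi> i j. poly (M $ i $ j) x)"
  by (simp add: det_def poly_sum poly_prod of_int_poly)

lemma poly_charpoly: "poly (charpoly A) x = det (x *\<^sub>R mat 1 - A)"
  unfolding charpoly_def poly_det
  by (rule arg_cong[where f = det]) (simp add: vec_eq_iff mat_def)

text \<open>
  Adding the other rows of \<open>x I - A\<close>, weighted by \<open>v\<close>, to row \<open>k\<close> turns that row into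
  \<open>(x - l) v\<close>, which splits off one factor \<open>x - l\<close>; the cofactor does not vanish at \<open>l\<close>.
\<close>

lemma order_charpoly_positive_eigenpair:
  fixes A :: "real ^ 'n ^ 'n"
  assumes pair: "positive_eigenpair A l u v"
    and mult: "\<And>w. A *v w = l *\<^sub>R w \<Longrightarrow> \<exists>c. w = c *\<^sub>R u"
  shows "order l (charpoly A) = 1"
proof -
  \<comment> \<open>The index is arbitrary: every coordinate of \<open>v\<close> is positive, so
    division by \<open>v $ k\<close> is possible.\<close>
  fix k :: 'n
  have uv_pos: "u \<in> S_pos" "v \<in> S_pos"
    using pair by (auto simp: positive_eigenpair_def)
  then have vk: "v $ k > 0" and uv: "u \<bullet> v > 0"
    using inner_S_plus_S_pos[of u v] S_pos_subset_S_plus by (auto simp: S_pos_def)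
  have left: "(\<Sum>i\<in>UNIV. A $ i $ j * v $ i) = l * v $ j" for j
    using pair by (auto simp: positive_eigenpair_def vec_eq_iff matrix_vector_mult_def transpose_def mult.commute)
  define M where "M x = (\<chi> i. if i = k then v else row i (x *\<^sub>R mat 1 - A))" for x :: real
  define q where "q = det (\<chi> i j. if i = k then [:v $ j:]
      else (if i = j then [:0, 1:] else 0) - [:A $ i $ j:])"
  have poly_q: "poly q x = det (M x)" for x
    unfolding q_def M_def poly_det
    by (rule arg_cong[where f = det]) (simp add: vec_eq_iff mat_def row_def)
  have "v $ k * det (x *\<^sub>R mat 1 - A) = (x - l) * det (M x)" for x
  proof -
    define B where "B = x *\<^sub>R mat 1 - A"
    \<comment> \<open>The left eigenvector equation for \<open>v\<close>, read as an identity
      between the rows of \<open>x I - A\<close>.\<close>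
    have comb: "(\<Sum>i\<in>UNIV. v $ i *s row i B) = (x - l) *s v"
    proof (subst vec_eq_iff, rule allI)
      fix j
      have "(\<Sum>i\<in>UNIV. v $ i *s row i B) $ j =
          (\<Sum>i\<in>UNIV. (if i = j then x * v $ i else 0) - A $ i $ j * v $ i)"
        by (auto simp: B_def mat_def row_def algebra_simps intro!: sum.cong)
      also have "\<dots> = ((x - l) *s v) $ j"
        by (simp add: sum_subtractf left left_diff_distrib)
      finally show "(\<Sum>i\<in>UNIV. v $ i *s row i B) $ j = ((x - l) *s v) $ j" .
    qed
    define w where "w = (\<Sum>i\<in>UNIV - {k}. v $ i *s row i B)"
    have split: "v $ k *s row k B + w = (x - l) *s v"
      using comb by (simp add: w_def sum.remove[of UNIV k])
    \<comment> \<open>Adding a combination of the other rows to row \<open>k\<close> preserves the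
      determinant. Since row \<open>k\<close> itself has weight \<open>v $ k\<close>, the
      combination is first divided by \<open>v $ k\<close>.\<close>
    have "w \<in> vec.span {row i B |i. i \<noteq> k}"
      unfolding w_def by (intro vec.span_sum vec.span_scale vec.span_base) auto
    then have "inverse (v $ k) *s w \<in> vec.span {row i B |i. i \<noteq> k}"
      by (rule vec.span_scale)
    then have "det B = det (\<chi> i. if i = k then row k B + inverse (v $ k) *s w else row i B)"
      by (rule det_row_span[symmetric])
    then have "v $ k * det B =
        det (\<chi> i. if i = k then v $ k *s (row k B + inverse (v $ k) *s w) else row i B)"
      by (subst det_row_mul) simp
    also have "v $ k *s (row k B + inverse (v $ k) *s w) = (x - l) *s v"
      using vk split by (simp add: vector_add_ldistrib vector_smult_assoc)
    also have "det (\<chi> i. if i = k then (x - l) *s v else row i B) = (x - l) * det (M x)"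
      unfolding M_def B_def by (subst det_row_mul) simp
    finally show ?thesis
      unfolding B_def .
  qed
  then have "poly (smult (v $ k) (charpoly A)) x = poly ([:- l, 1:] * q) x" for x
    by (simp add: poly_charpoly poly_q algebra_simps)
  then have factor: "smult (v $ k) (charpoly A) = [:- l, 1:] * q"
    by (simp add: poly_eq_poly_eq_iff[symmetric] fun_eq_iff)
  \<comment> \<open>A kernel vector \<open>w\<close> of \<open>M l\<close> is orthogonal to
    \<open>v\<close> and satisfies every row of \<open>A *v w = l *\<^sub>R w\<close> except row
    \<open>k\<close>. Pairing with \<open>v\<close> recovers row \<open>k\<close>, so
    \<open>w\<close> is a multiple of \<open>u\<close>; but
    \<open>u \<bullet> v > 0\<close>.\<close>
  have "det (M l) \<noteq> 0"
  proof
    assume "det (M l) = 0"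
    then have "\<not> (\<forall>w. M l *v w = 0 \<longrightarrow> w = 0)"
      unfolding matrix_left_invertible_ker[symmetric] invertible_left_inverse[symmetric]
        invertible_det_nz by simp
    then obtain w where w: "w \<noteq> 0" "M l *v w = 0"
      by blast
    have row0: "(l *\<^sub>R w - A *v w) $ i = 0" if "i \<noteq> k" for i
    proof -
      have "(M l *v w) $ i = (\<Sum>j\<in>UNIV. (if i = j then l * w $ j else 0) - A $ i $ j * w $ j)"
        using that
        by (auto simp: M_def matrix_vector_mult_def row_def mat_def algebra_simps intro!: sum.cong)
      also have "\<dots> = (l *\<^sub>R w - A *v w) $ i"
        by (simp add: sum_subtractf matrix_vector_mult_def)
      finally show ?thesis
        using w by simp
    qed
    have vw: "v \<bullet> w = 0"
      using arg_cong[OF w(2), of "\<lambda>y. y $ k"] by (simp add: M_def matrix_vector_mult_def inner_vec_def)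
    have "(A *v w) \<bullet> v = 0"
      using vw pair unfolding inner_matrix_transpose positive_eigenpair_def
      by (simp add: inner_commute)
    then have "v \<bullet> (l *\<^sub>R w - A *v w) = 0"
      using vw by (simp add: inner_diff_right inner_commute)
    moreover have "v \<bullet> (l *\<^sub>R w - A *v w) = v $ k * (l *\<^sub>R w - A *v w) $ k"
      unfolding inner_vec_def using row0 by (subst sum.remove[of UNIV k]) auto
    ultimately have "(l *\<^sub>R w - A *v w) $ k = 0"
      using vk by simp
    then have "l *\<^sub>R w - A *v w = 0"
      using row0 by (metis vec_eq_iff zero_index)
    then obtain c where "w = c *\<^sub>R u"
      using mult[of w] by auto
    then show False
      using vw uv w(1) by (simp add: inner_commute)
  qed
  then have "poly q l \<noteq> 0"
    by (simp add: poly_q)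
  then have "[:- l, 1:] * q \<noteq> 0" "order l q = 0"
    by (auto simp: order_0I simp del: mult_pCons_left)
  then have "order l ([:- l, 1:] * q) = 1"
    using order_power_n_n[of l 1] by (subst order_mult) simp_all
  then show ?thesis
    unfolding factor[symmetric] using vk by (simp add: order_smult)
qed

section \<open>Quasi-eigenvalues\<close>

text \<open>Here and in the next three lemmas, one fixed \<open>v\<close> gives an upper bound and
  one fixed \<open>u\<close> a lower bound. The fixed vector lies in \<open>S_plus\<close> if it is
  the outer variable and in \<open>S_pos\<close> if it is the inner one.\<close>

lemma upper_qev_le:
  assumes "v \<in> S_pos" "\<And>u. u \<in> S_plus \<Longrightarrow> lam B u v \<le> t"
  shows "upper_qev B \<le> ereal t"
  unfolding upper_qev_def using assms by (intro SUP_least) (auto intro: INF_lower2)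

lemma upper_qev_ge:
  assumes "u \<in> S_plus" "\<And>v. v \<in> S_pos \<Longrightarrow> t \<le> lam B u v"
  shows "ereal t \<le> upper_qev B"
  unfolding upper_qev_def using assms by (intro SUP_upper2[of u]) (auto intro: INF_greatest)

lemma lower_qev_le:
  assumes "v \<in> S_plus" "\<And>u. u \<in> S_pos \<Longrightarrow> lam B u v \<le> t"
  shows "lower_qev B \<le> ereal t"
  unfolding lower_qev_def using assms by (intro INF_lower2[of v]) (auto intro: SUP_least)

lemma lower_qev_ge:
  assumes "u \<in> S_pos" "\<And>v. v \<in> S_plus \<Longrightarrow> t \<le> lam B u v"
  shows "ereal t \<le> lower_qev B"
  unfolding lower_qev_def using assms by (intro INF_greatest) (auto intro: SUP_upper2)

lemma lam_add: "lam (A + D) u v = lam A u v + lam D u v"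
  by (simp add: lam_def matrix_vector_mult_add_rdistrib inner_add_left add_divide_distrib)

lemma lam_right_eigenvector: "A *v u = l *\<^sub>R u \<Longrightarrow> u \<bullet> v \<noteq> 0 \<Longrightarrow> lam A u v = l"
  by (simp add: lam_def)

lemma lam_left_eigenvector: "transpose A *v v = l *\<^sub>R v \<Longrightarrow> u \<bullet> v \<noteq> 0 \<Longrightarrow> lam A u v = l"
  by (simp add: lam_def inner_matrix_transpose)

text \<open>The quotient \<open>lam A\<close> is constantly \<open>l\<close> once either argument is
  fixed at its eigenvector: \<open>u\<close> gives both lower bounds and \<open>v\<close> both upper
  bounds.\<close>

lemma qev_positive_eigenpair:
  assumes "positive_eigenpair A l u v"
  shows "upper_qev A = ereal l" "lower_qev A = ereal l"
proof -
  have uv: "u \<in> S_pos" "v \<in> S_pos" "u \<in> S_plus" "v \<in> S_plus"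
    and eig: "A *v u = l *\<^sub>R u" "transpose A *v v = l *\<^sub>R v"
    using assms S_pos_subset_S_plus by (auto simp: positive_eigenpair_def)
  have right: "lam A u y = l" if "y \<in> S_plus" for y
    using eig(1) inner_S_pos_S_plus[OF uv(1) that] by (intro lam_right_eigenvector) auto
  have left: "lam A x v = l" if "x \<in> S_plus" for x
    using eig(2) inner_S_plus_S_pos[OF that uv(2)] by (intro lam_left_eigenvector) auto
  show "upper_qev A = ereal l"
    using uv right left S_pos_subset_S_plus
    by (intro antisym upper_qev_le[of v] upper_qev_ge[of u]) (auto simp: subset_iff)
  show "lower_qev A = ereal l"
    using uv right left S_pos_subset_S_plus
    by (intro antisym lower_qev_le[of v] lower_qev_ge[of u]) (auto simp: subset_iff)
qed

text \<open>If the infimum is \<open>l\<close>, then \<open>A *v u - l *\<^sub>R u\<close> pairs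
  nonnegatively with all of \<open>S_pos\<close>, and its pairing with the left eigenvector
  \<open>v0\<close> is 0, so it vanishes. Conversely, an eigenvector makes \<open>lam A u\<close>
  constant on \<open>S_pos\<close>.\<close>

lemma right_quasi_eigenvector_iff:
  assumes pair: "positive_eigenpair A l u0 v0"
  shows "right_quasi_eigenvector A u \<longleftrightarrow> u \<in> S_plus \<and> A *v u = l *\<^sub>R u"
proof
  assume "right_quasi_eigenvector A u"
  then have u: "u \<in> S_plus" and inf: "ereal l = (INF v\<in>S_pos. ereal (lam A u v))"
    using qev_positive_eigenpair[OF pair] by (auto simp: right_quasi_eigenvector_def)
  have "0 \<le> (A *v u - l *\<^sub>R u) \<bullet> v" if "v \<in> S_pos" for v
  proof -
    have "ereal l \<le> ereal (lam A u v)"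
      unfolding inf using that by (rule INF_lower)
    then show ?thesis
      using inner_S_plus_S_pos[OF u that] by (simp add: lam_def inner_diff_left field_simps)
  qed
  moreover have "v0 \<in> S_pos" "(A *v u - l *\<^sub>R u) \<bullet> v0 = 0"
    using pair by (auto simp: positive_eigenpair_def inner_diff_left inner_matrix_transpose)
  ultimately have "A *v u - l *\<^sub>R u = 0"
    by (rule inner_nonneg_on_S_pos_eq_0)
  then show "u \<in> S_plus \<and> A *v u = l *\<^sub>R u"
    using u by simp
next
  assume u: "u \<in> S_plus \<and> A *v u = l *\<^sub>R u"
  then have "lam A u v = l" if "v \<in> S_pos" for v
    using inner_S_plus_S_pos[of u v] that by (intro lam_right_eigenvector) auto
  \<comment> \<open>This shows that \<open>S_pos\<close> is nonempty; an infimum over the empty set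
    would be \<open>\<infinity>\<close>.\<close>
  moreover have "v0 \<in> S_pos"
    using pair by (simp add: positive_eigenpair_def)
  ultimately have "(INF v\<in>S_pos. ereal (lam A u v)) = ereal l"
    by (subst INF_cong[OF refl, of _ _ "\<lambda>_. ereal l"]) (auto intro!: INF_const)
  then show "right_quasi_eigenvector A u"
    using u qev_positive_eigenpair[OF pair] by (simp add: right_quasi_eigenvector_def)
qed

text \<open>The duality behind the statements on left vectors: transposing swaps the two arguments,
  and negating exchanges infima and suprema.\<close>

lemma lam_uminus_transpose: "lam (- transpose A) v u = - lam A u v"
proof -
  have "(transpose A *v v) \<bullet> u = (A *v u) \<bullet> v"
    by (metis inner_matrix_transpose inner_commute)
  then show ?thesis
    unfolding lam_def uminus_matrix_vector_mult inner_minus_left inner_commute[of v u] by simp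
qed

lemma left_quasi_eigenvector_iff_right:
  "left_quasi_eigenvector A v \<longleftrightarrow> right_quasi_eigenvector (- transpose A) v"
  by (simp add: left_quasi_eigenvector_def right_quasi_eigenvector_def lower_qev_def upper_qev_def
      lam_uminus_transpose ereal_SUP_uminus_eq ereal_INF_uminus_eq flip: uminus_ereal.simps(1))

lemma left_quasi_eigenvector_iff:
  assumes "positive_eigenpair A l u0 v0"
  shows "left_quasi_eigenvector A v \<longleftrightarrow> v \<in> S_plus \<and> transpose A *v v = l *\<^sub>R v"
proof -
  \<comment> \<open>The dual matrix has eigenvalue \<open>- l\<close>, with the two eigenvectors
    exchanged.\<close>
  have "positive_eigenpair (- transpose A) (- l) v0 u0"
    using assms by (auto simp: positive_eigenpair_def uminus_matrix_vector_mult transpose_uminus)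
  from right_quasi_eigenvector_iff[OF this] show ?thesis
    by (simp add: left_quasi_eigenvector_iff_right uminus_matrix_vector_mult)
qed

section \<open>Saddle points\<close>

text \<open>This is the quotient rule after moving \<open>A\<close> to the fixed argument. The
  gradient vanishes exactly when \<open>v\<close> satisfies the left eigenvalue equation with value
  \<open>lam A u v\<close>.\<close>

lemma GDERIV_lam_left:
  assumes "u \<bullet> v \<noteq> 0"
  shows "GDERIV (\<lambda>x. lam A x v) u :>
    inverse (u \<bullet> v) *\<^sub>R (transpose A *v v - lam A u v *\<^sub>R v)"
  unfolding gderiv_def lam_def inner_matrix_transpose
  using assms
  by (auto intro!: derivative_eq_intros
      simp: inner_diff_right inner_commute fun_eq_iff field_simps)

lemma GDERIV_lam_right:
  assumes "u \<bullet> v \<noteq> 0"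
  shows "GDERIV (\<lambda>y. lam A u y) v :> inverse (u \<bullet> v) *\<^sub>R (A *v u - lam A u v *\<^sub>R u)"
  unfolding gderiv_def lam_def
  using assms
  by (auto intro!: derivative_eq_intros
      simp: inner_diff_right inner_commute fun_eq_iff field_simps)

lemma GDERIV_unique:
  assumes "GDERIV f x :> D" "GDERIV f x :> E"
  shows "D = E"
proof -
  have "(\<lambda>h. h \<bullet> D) = (\<lambda>h. h \<bullet> E)"
    using assms has_derivative_unique unfolding gderiv_def by blast
  then show ?thesis
    by (metis vector_eq_ldot)
qed

text \<open>Vanishing gradients are eigenvalue equations with the value \<open>lam A u v\<close>,
  and equality with the quasi-eigenvalues identifies this value as \<open>l\<close>.\<close>

lemma saddle_point_iff:
  assumes pair: "positive_eigenpair A l u0 v0"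
  shows "saddle_point A u v \<longleftrightarrow>
    u \<in> S_plus \<and> v \<in> S_plus \<and> u \<bullet> v \<noteq> 0 \<and> A *v u = l *\<^sub>R u \<and> transpose A *v v = l *\<^sub>R v"
proof -
  have gderiv_0: "GDERIV f x :> 0 \<longleftrightarrow> D = 0" if "GDERIV f x :> D" for f x and D :: "real ^ 'a"
    using that GDERIV_unique by blast
  show ?thesis
  proof (cases "u \<bullet> v = 0")
    case False
    have "GDERIV (\<lambda>x. lam A x v) u :> 0 \<longleftrightarrow> transpose A *v v = lam A u v *\<^sub>R v"
      "GDERIV (\<lambda>y. lam A u y) v :> 0 \<longleftrightarrow> A *v u = lam A u v *\<^sub>R u"
      using False gderiv_0[OF GDERIV_lam_left[OF False]] gderiv_0[OF GDERIV_lam_right[OF False]]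
      by auto
    then show ?thesis
      using False lam_right_eigenvector[of A u l v]
      by (auto simp: saddle_point_def qev_positive_eigenpair[OF pair])
  qed (simp add: saddle_point_def)
qed

section \<open>Perturbation\<close>

text \<open>For \<open>u\<close> in \<open>S_plus\<close> the norm is at most the sum of the
  coordinates, and \<open>u \<bullet> v\<close> is at least the smallest coordinate of
  \<open>v\<close> times that sum. This makes \<open>c0\<close> finite.\<close>

lemma norm_le_inner_S_pos:
  fixes v :: "real ^ 'n"
  assumes "v \<in> S_pos"
  shows "\<exists>c. \<forall>u\<in>S_plus. norm u / (u \<bullet> v) \<le> c"
proof -
  define m where "m = Min (range (($) v))"
  have "m \<in> range (($) v)"
    unfolding m_def by (rule Min_in) auto
  then have "0 < m"
    using assms by (auto simp: S_pos_def)
  have "norm u / (u \<bullet> v) \<le> 1 / m" if "u \<in> S_plus" for u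
  proof -
    have nonneg: "0 \<le> u $ i" for i
      using that by (simp add: S_plus_iff)
    have "norm u * m \<le> (\<Sum>i\<in>UNIV. u $ i) * m"
      using norm_le_l1_cart[of u] nonneg \<open>0 < m\<close> by (intro mult_right_mono) auto
    also have "\<dots> \<le> u \<bullet> v"
      unfolding inner_vec_def sum_distrib_right
      using nonneg by (auto intro!: sum_mono mult_left_mono Min_le simp: m_def)
    finally show ?thesis
      using \<open>0 < m\<close> inner_S_plus_S_pos[OF that assms] by (simp add: field_simps)
  qed
  then show ?thesis
    by blast
qed

lemma c0_real:
  fixes u0 v0 :: "real ^ 'n"
  assumes "u0 \<in> S_pos" "v0 \<in> S_pos"
  obtains c where "c0 u0 v0 = ereal c"
    "\<And>u. u \<in> S_plus \<Longrightarrow> norm u / (u \<bullet> v0) \<le> c"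
    "\<And>v. v \<in> S_plus \<Longrightarrow> norm v / (u0 \<bullet> v) \<le> c"
proof -
  obtain a b where a: "\<forall>u\<in>S_plus. norm u / (u \<bullet> v0) \<le> a"
    and b: "\<forall>v\<in>S_plus. norm v / (v \<bullet> u0) \<le> b"
    using assms norm_le_inner_S_pos by blast
  have "c0 u0 v0 \<le> ereal (max a b)"
    unfolding c0_def
    using a b by (intro max.boundedI SUP_least) (auto simp: inner_commute le_max_iff_disj)
  moreover have ge: "ereal (norm u / (u \<bullet> v0)) \<le> c0 u0 v0" "ereal (norm u / (u0 \<bullet> u)) \<le> c0 u0 v0"
    if "u \<in> S_plus" for u
    unfolding c0_def using that by (auto intro: SUP_upper max.coboundedI1 max.coboundedI2)
  \<comment> \<open>The quotient at this vector is a real lower bound of \<open>c0 u0 v0\<close>,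
    which excludes \<open>-\<infinity>\<close>.\<close>
  moreover have "u0 \<in> S_plus"
    using assms S_pos_subset_S_plus by blast
  ultimately obtain c where "c0 u0 v0 = ereal c"
    by (metis ereal_cases ereal_infty_less_eq(1,2) PInfty_neq_ereal(1) MInfty_neq_ereal(1))
  with ge show thesis
    by (intro that[of c]) auto
qed

lemma abs_lam_le:
  assumes "0 < u \<bullet> v"
  shows "\<bar>lam D u v\<bar> \<le> norm u * norm v / (u \<bullet> v) * onorm ((*v) D)"
proof -
  have "\<bar>(D *v u) \<bullet> v\<bar> \<le> norm (D *v u) * norm v"
    by (rule Cauchy_Schwarz_ineq2)
  also have "\<dots> \<le> onorm ((*v) D) * norm u * norm v"
    using onorm[OF matrix_vector_mul_bounded_linear, of D u] by (intro mult_right_mono) auto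
  finally show ?thesis
    using assms by (simp add: lam_def field_simps)
qed

lemma abs_lam_le_c0:
  assumes "0 < u \<bullet> v" "norm u * norm v / (u \<bullet> v) \<le> c"
  shows "\<bar>lam D u v\<bar> \<le> c * onorm ((*v) D)"
proof -
  have "0 \<le> onorm ((*v) D)"
    by (intro onorm_pos_le matrix_vector_mul_bounded_linear)
  then show ?thesis
    using abs_lam_le[OF assms(1), of D] assms(2) by (meson mult_right_mono order_trans)
qed

lemma lam_nonneg:
  assumes "\<forall>i j. 0 \<le> D $ i $ j" "u \<in> S_plus" "v \<in> S_plus"
  shows "0 \<le> lam D u v"
  using assms unfolding lam_def inner_vec_def matrix_vector_mult_def S_plus_iff
  by (auto intro!: divide_nonneg_nonneg sum_nonneg mult_nonneg_nonneg)

text \<open>Fixing \<open>v\<close> bounds both quasi-eigenvalues of \<open>A + D\<close> above by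
  \<open>l + d\<close>, and fixing \<open>u\<close> bounds them below by \<open>l - d\<close>. Norm
  one of the fixed vector reduces the factor in \<open>abs_lam_le_c0\<close> to a quotient occurring
  in \<open>c0\<close>.\<close>

lemma qev_perturbation:
  fixes A D :: "real ^ 'n ^ 'n"
  assumes pair: "positive_eigenpair A l u v" and norms: "norm u = 1" "norm v = 1"
  shows "max \<bar>lower_qev (A + D) - ereal l\<bar> \<bar>upper_qev (A + D) - ereal l\<bar>
    \<le> c0 u v * ereal (onorm ((*v) D))"
proof -
  have uv: "u \<in> S_pos" "v \<in> S_pos" "u \<in> S_plus" "v \<in> S_plus"
    and eig: "A *v u = l *\<^sub>R u" "transpose A *v v = l *\<^sub>R v"
    using pair S_pos_subset_S_plus by (auto simp: positive_eigenpair_def)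
  obtain c where c: "c0 u v = ereal c"
    and left: "\<And>x. x \<in> S_plus \<Longrightarrow> norm x / (x \<bullet> v) \<le> c"
    and right: "\<And>y. y \<in> S_plus \<Longrightarrow> norm y / (u \<bullet> y) \<le> c"
    using c0_real uv(1,2) by metis
  define d where "d = c * onorm ((*v) D)"
  have le: "lam (A + D) x v \<le> l + d" if "x \<in> S_plus" for x
    using inner_S_plus_S_pos[OF that uv(2)] abs_lam_le_c0[of x v c D] left[OF that] norms
      lam_left_eigenvector[OF eig(2), of x] by (simp add: lam_add d_def)
  have ge: "l - d \<le> lam (A + D) u y" if "y \<in> S_plus" for y
    using inner_S_pos_S_plus[OF uv(1) that] abs_lam_le_c0[of u y c D] right[OF that] norms
      lam_right_eigenvector[OF eig(1), of y] by (simp add: lam_add d_def)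
  \<comment> \<open>The two real bounds also exclude infinite values of \<open>q\<close>.\<close>
  have bounds: "\<bar>q - ereal l\<bar> \<le> ereal d" if "ereal (l - d) \<le> q" "q \<le> ereal (l + d)" for q
    using that by (cases q) auto
  have "\<bar>upper_qev (A + D) - ereal l\<bar> \<le> ereal d"
    using uv le ge S_pos_subset_S_plus
    by (intro bounds upper_qev_le[of v] upper_qev_ge[of u]) blast+
  moreover have "\<bar>lower_qev (A + D) - ereal l\<bar> \<le> ereal d"
    using uv le ge S_pos_subset_S_plus
    by (intro bounds lower_qev_le[of v] lower_qev_ge[of u]) blast+
  ultimately show ?thesis
    by (simp add: c d_def)
qed

text \<open>At the fixed right eigenvector \<open>u\<close>, the matrix \<open>A\<close> contributes
  exactly \<open>l\<close> and \<open>D\<close> a nonnegative amount.\<close>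

lemma lower_qev_mono:
  assumes pair: "positive_eigenpair A l u v" and D: "\<forall>i j. 0 \<le> D $ i $ j"
  shows "ereal l \<le> lower_qev (A + D)"
proof (rule lower_qev_ge[of u])
  show u: "u \<in> S_pos"
    using pair by (simp add: positive_eigenpair_def)
  fix y :: "real ^ 'a"
  assume y: "y \<in> S_plus"
  have "lam A u y = l"
    using pair inner_S_pos_S_plus[OF u y] lam_right_eigenvector[of A u l y]
    by (simp add: positive_eigenpair_def)
  moreover have "0 \<le> lam D u y"
    using D u y S_pos_subset_S_plus by (intro lam_nonneg) auto
  ultimately show "l \<le> lam (A + D) u y"
    by (simp add: lam_add)
qed

text \<open>The same argument at the fixed left eigenvector \<open>v\<close>, with
  \<open>- D\<close> as the nonnegative matrix.\<close>

lemma upper_qev_mono: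
  assumes pair: "positive_eigenpair A l u v" and D: "\<forall>i j. D $ i $ j \<le> 0"
  shows "upper_qev (A + D) \<le> ereal l"
proof (rule upper_qev_le[of v])
  show v: "v \<in> S_pos"
    using pair by (simp add: positive_eigenpair_def)
  fix x :: "real ^ 'a"
  assume x: "x \<in> S_plus"
  have "lam A x v = l"
    using pair inner_S_plus_S_pos[OF x v] lam_left_eigenvector[of A v l x]
    by (simp add: positive_eigenpair_def)
  moreover have "0 \<le> lam (- D) x v"
    using D x v S_pos_subset_S_plus by (intro lam_nonneg) auto
  then have "lam D x v \<le> 0"
    by (simp add: lam_def uminus_matrix_vector_mult)
  ultimately show "lam (A + D) x v \<le> l"
    by (simp add: lam_add)
qed

theorem theorem1p3:
  fixes A :: "real ^ 'n::{finite,linorder} ^ 'n::{finite,linorder}"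
  assumes "irreducible_matrix A"
    and "sign_constant_off_diag A"
  shows "\<exists>l::real.
    upper_qev A = ereal l \<and> lower_qev A = ereal l \<and>
    simple_eigenvalue A l \<and>
    (\<exists>u v. right_quasi_eigenvector A u \<and> left_quasi_eigenvector A v \<and>
      norm u = 1 \<and> norm v = 1) \<and>
    (\<forall>u v. right_quasi_eigenvector A u \<and> left_quasi_eigenvector A v \<longrightarrow>
      u \<in> S_pos \<and> A *v u = l *\<^sub>R u \<and>
      v \<in> S_pos \<and> transpose A *v v = l *\<^sub>R v \<and>
      saddle_point A u v \<and>
      (\<forall>u' v'. saddle_point A u' v' \<longrightarrow>
        (\<exists>c d. c > 0 \<and> d > 0 \<and> u' = c *\<^sub>R u \<and> v' = d *\<^sub>R v))) \<and>
    (\<forall>u v. right_quasi_eigenvector A u \<and> left_quasi_eigenvector A v \<and>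
      norm u = 1 \<and> norm v = 1 \<longrightarrow>
      c0 u v < \<infinity> \<and>
      (\<forall>D.
        max \<bar>lower_qev (A + D) - ereal l\<bar> \<bar>upper_qev (A + D) - ereal l\<bar>
          \<le> c0 u v * ereal (onorm ((*v) D)))) \<and>
    (\<forall>D. (\<forall>i j. 0 \<le> D $ i $ j) \<longrightarrow> ereal l \<le> lower_qev (A + D)) \<and>
    (\<forall>D. (\<forall>i j. D $ i $ j \<le> 0) \<longrightarrow> upper_qev (A + D) \<le> ereal l)"
proof -
  have conn: "strongly_connected A" "strongly_connected (transpose A)"
    using assms(1) irreducible_imp_strongly_connected strongly_connected_transpose by blast+
  have sign: "sign_constant_off_diag A" "sign_constant_off_diag (transpose A)"
    using assms(2) sign_constant_off_diag_transpose by blast+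
  obtain l u0 v0 where pair: "positive_eigenpair A l u0 v0"
    using ex_positive_eigenpair conn(1) sign(1) by blast
  then have pos0: "u0 \<in> S_pos" "v0 \<in> S_pos"
    and eig0: "A *v u0 = l *\<^sub>R u0" "transpose A *v v0 = l *\<^sub>R v0"
    by (auto simp: positive_eigenpair_def)
  \<comment> \<open>Any choice of quasi-eigenvectors is again a positive eigenpair for the same
    \<open>l\<close>, so whatever is shown for such pairs holds for every choice.\<close>
  have quasi: "positive_eigenpair A l u v"
    if "right_quasi_eigenvector A u" "left_quasi_eigenvector A v" for u v
    using that nonneg_eigenvector_pos[OF conn(1) sign(1)] nonneg_eigenvector_pos[OF conn(2) sign(2)]
    unfolding right_quasi_eigenvector_iff[OF pair] left_quasi_eigenvector_iff[OF pair]
      positive_eigenpair_def by blast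
  \<comment> \<open>A general \<open>B\<close> covers both \<open>A\<close> and its transpose. The
    factor is positive because \<open>x' \<bullet> x = c * (x \<bullet> x)\<close> is.\<close>
  have pos_multiple: "\<exists>c>0. x' = c *\<^sub>R x"
    if B: "strongly_connected B" "sign_constant_off_diag B" "x \<in> S_pos" "B *v x = l *\<^sub>R x"
      "x' \<in> S_plus" "B *v x' = l *\<^sub>R x'" for B :: "real ^ 'n::{finite,linorder} ^ 'n::{finite,linorder}" and x x'
  proof -
    obtain c where c: "x' = c *\<^sub>R x"
      using eigenvector_multiple[OF B(1-4) B(6)] by blast
    then have "0 < c * (x \<bullet> x)"
      using inner_S_plus_S_pos[OF B(5,3)] by simp
    then show ?thesis
      using c by (metis inner_ge_zero zero_less_mult_pos2 mult_le_0_iff not_less)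
  qed
  have unique: "\<exists>c d. c > 0 \<and> d > 0 \<and> u' = c *\<^sub>R u \<and> v' = d *\<^sub>R v"
    if "positive_eigenpair A l u v" "saddle_point A u' v'" for u v u' v'
    using that(1) that(2)[unfolded saddle_point_iff[OF pair]]
      pos_multiple[OF conn(1) sign(1)] pos_multiple[OF conn(2) sign(2)]
    unfolding positive_eigenpair_def by metis
  have saddle: "saddle_point A u v" if "positive_eigenpair A l u v" for u v
    using that S_pos_subset_S_plus inner_S_plus_S_pos[of u v]
    unfolding saddle_point_iff[OF pair] positive_eigenpair_def by fastforce
  have nz: "u0 \<noteq> 0" "v0 \<noteq> 0"
    using pos0 S_pos_subset_S_plus by (auto simp: S_plus_def)
  have simple: "simple_eigenvalue A l"
    unfolding simple_eigenvalue_def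
    using order_charpoly_positive_eigenpair[OF pair eigenvector_multiple[OF conn(1) sign(1) pos0(1) eig0(1)]]
      nz eig0 by blast
  have ex: "\<exists>u v. right_quasi_eigenvector A u \<and> left_quasi_eigenvector A v \<and> norm u = 1 \<and> norm v = 1"
  proof (intro exI conjI)
    have "inverse (norm u0) *\<^sub>R u0 \<in> S_plus" "inverse (norm v0) *\<^sub>R v0 \<in> S_plus"
      using pos0 nz by (auto intro!: scaleR_S_pos subsetD[OF S_pos_subset_S_plus])
    then show "right_quasi_eigenvector A (inverse (norm u0) *\<^sub>R u0)"
      "left_quasi_eigenvector A (inverse (norm v0) *\<^sub>R v0)"
      using eig0 unfolding right_quasi_eigenvector_iff[OF pair] left_quasi_eigenvector_iff[OF pair]
      by (simp_all add: matrix_vector_mult_scaleR)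
    show "norm (inverse (norm u0) *\<^sub>R u0) = 1" "norm (inverse (norm v0) *\<^sub>R v0) = 1"
      using nz by simp_all
  qed
  have finite: "c0 u v < \<infinity>" if "positive_eigenpair A l u v" for u v
    using that c0_real[of u v] unfolding positive_eigenpair_def by (metis ereal_infty_less(1) PInfty_neq_ereal(1))
  show ?thesis
  proof (rule exI[of _ l], intro conjI)
    show "\<forall>u v. right_quasi_eigenvector A u \<and> left_quasi_eigenvector A v \<longrightarrow>
      u \<in> S_pos \<and> A *v u = l *\<^sub>R u \<and>
      v \<in> S_pos \<and> transpose A *v v = l *\<^sub>R v \<and>
      saddle_point A u v \<and>
      (\<forall>u' v'. saddle_point A u' v' \<longrightarrow>
        (\<exists>c d. c > 0 \<and> d > 0 \<and> u' = c *\<^sub>R u \<and> v' = d *\<^sub>R v))"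
      using quasi saddle unique unfolding positive_eigenpair_def by blast
  qed (use qev_positive_eigenpair[OF pair] simple ex quasi finite qev_perturbation
      lower_qev_mono[OF pair] upper_qev_mono[OF pair] in blast)+
qed

end
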